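(* For $1\le i\le 15$ let $P_i=\{2i-1,2i\}$ and $Q_i=\{30+2i-1,30+2i\}$, and let \[ \mathcal{B}=\{P_i\cup P_j\cup P_k:\ 1\le i<j<k\le 15\}\ \cup\ \{Q_i\cup Q_j\cup Q_k:\ 1\le i<j<k\le 15\}, \] a family of $910$ six-element subsets of $[60]=\{1,\dots,60\}$. Then for every $S\subset[60]$ with $|S|=6$ there exists $B\in\mathcal{B}$ with $|S\cap B|\ge 3$. Equivalently, every vertex of the Johnson graph $J(60,6)$ lies at Johnson distance at most $3$ from some element of $\mathcal{B}$, i.e. $\mathcal{B}$ has covering radius $3$ in $J(60,6)$.
   Context: The Johnson graph $J(60,6)$ has vertex set the $6$-subsets of $[60]$, two vertices adjacent when they differ in exactly one element; the Johnson distance between $6$-subsets $S,B$ is $d_J(S,B)=6-|S\cap B|$. *)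

theory Defs
  imports Main
begin

definition johnson_vertices :: "nat \<Rightarrow> nat \<Rightarrow> nat set set" where
  "johnson_vertices n k = {S. S \<subseteq> {1..n} \<and> card S = k}"

definition johnson_edges :: "nat \<Rightarrow> nat \<Rightarrow> (nat set \<times> nat set) set" where
  "johnson_edges n k = {(S, T). S \<in> johnson_vertices n k \<and> T \<in> johnson_vertices n k
     \<and> card (S - T) = 1 \<and> card (T - S) = 1}"

text \<open>For \<open>k\<close>-subsets the subtraction on \<^typ>\<open>nat\<close> never truncates. The lemma
  \<open>johnson_dist_is_graph_distance\<close> below identifies this with the shortest-path distance
  in the Johnson graph.\<close>
definition johnson_dist :: "nat \<Rightarrow> nat set \<Rightarrow> nat set \<Rightarrow> nat" where
  "johnson_dist k S B = k - card (S \<inter> B)"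

text \<open>The largest distance from a vertex to the code \<open>C\<close>. The maximum and minimum range over
  finite sets; they are meaningful for \<open>k \<le> n\<close> and nonempty \<open>C \<subseteq> johnson_vertices n k\<close>.\<close>
definition johnson_covering_radius :: "nat \<Rightarrow> nat \<Rightarrow> nat set set \<Rightarrow> nat" where
  "johnson_covering_radius n k C =
     Max ((\<lambda>S. Min (johnson_dist k S ` C)) ` johnson_vertices n k)"

definition P_pair :: "nat \<Rightarrow> nat set" where
  "P_pair i = {2 * i - 1, 2 * i}"

definition Q_pair :: "nat \<Rightarrow> nat set" where
  "Q_pair i = {30 + 2 * i - 1, 30 + 2 * i}"

definition pair_code :: "nat set set" where
  "pair_code =
     {P_pair i \<union> P_pair j \<union> P_pair k | i j k. 1 \<le> i \<and> i < j \<and> j < k \<and> k \<le> 15} \<union>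
     {Q_pair i \<union> Q_pair j \<union> Q_pair k | i j k. 1 \<le> i \<and> i < j \<and> j < k \<and> k \<le> 15}"

lemma johnson_vertices_finite: "S \<in> johnson_vertices n k \<Longrightarrow> finite S"
  unfolding johnson_vertices_def using finite_subset by blast

lemma johnson_dist_eq_card_Diff:
  assumes "S \<in> johnson_vertices n k"
  shows "johnson_dist k S T = card (S - T)"
  using assms johnson_vertices_finite[OF assms]
  by (simp add: johnson_dist_def johnson_vertices_def card_Diff_subset_Int)

lemma johnson_path_lower:
  assumes "S \<in> johnson_vertices n k" and "(S, T) \<in> johnson_edges n k ^^ m"
  shows "card (S - T) \<le> m"
  using assms(2)
proof (induction m arbitrary: T)
  case 0
  then show ?case by simp
next
  case (Suc m)
  then obtain U where U: "(S, U) \<in> johnson_edges n k ^^ m" "(U, T) \<in> johnson_edges n k"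
    by auto
  have fin: "finite S" "finite U"
    using U(2) johnson_vertices_finite assms(1) unfolding johnson_edges_def by blast+
  have "card (S - T) \<le> card ((S - U) \<union> (U - T))"
    using fin by (intro card_mono) auto
  also have "\<dots> \<le> card (S - U) + card (U - T)"
    by (rule card_Un_le)
  also have "\<dots> \<le> Suc m"
    using Suc.IH[OF U(1)] U(2) by (simp add: johnson_edges_def)
  finally show ?case .
qed

lemma johnson_path_upper:
  assumes "S \<in> johnson_vertices n k" "T \<in> johnson_vertices n k" "card (S - T) = m"
  shows "(S, T) \<in> johnson_edges n k ^^ m"
  using assms
proof (induction m arbitrary: S)
  case 0
  then have fin: "finite S" "finite T" using johnson_vertices_finite by blast+
  then have "S \<subseteq> T" using 0 by simp
  then have "S = T"
    using 0 fin card_subset_eq[of T S] by (simp add: johnson_vertices_def)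
  then show ?case by simp
next
  case (Suc m)
  have fin: "finite S" "finite T" using Suc.prems johnson_vertices_finite by blast+
  have cards: "card S = card T" using Suc.prems by (simp add: johnson_vertices_def)
  have "card (T - S) = card (S - T)"
    using fin cards by (simp add: card_Diff_subset_Int Int_commute)
  then have "card (T - S) \<noteq> 0" "card (S - T) \<noteq> 0" using Suc.prems(3) by simp_all
  then have "T - S \<noteq> {}" "S - T \<noteq> {}" by force+
  then obtain x y where xy: "x \<in> S" "x \<notin> T" "y \<in> T" "y \<notin> S" by blast
  define U where "U = insert y (S - {x})"
  have "card U = card S"
    using fin xy card.remove[of S x] by (simp add: U_def)
  then have U: "U \<in> johnson_vertices n k"
    using Suc.prems(1,2) xy unfolding johnson_vertices_def U_def by blast
  have "S - U = {x}" "U - S = {y}" using xy by (auto simp: U_def)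
  then have e: "(S, U) \<in> johnson_edges n k"
    using U Suc.prems by (simp add: johnson_edges_def)
  have "U - T = (S - T) - {x}" using xy by (auto simp: U_def)
  then have "card (U - T) = m" using xy fin Suc.prems(3) by simp
  then have "(U, T) \<in> johnson_edges n k ^^ m"
    by (rule Suc.IH[OF U Suc.prems(2)])
  with e show ?case by (rule relpow_Suc_I2)
qed

lemma johnson_dist_is_graph_distance:
  assumes "S \<in> johnson_vertices n k" "T \<in> johnson_vertices n k"
  shows "(LEAST m. (S, T) \<in> johnson_edges n k ^^ m) = johnson_dist k S T"
  unfolding johnson_dist_eq_card_Diff[OF assms(1)]
  using johnson_path_upper[OF assms refl] johnson_path_lower[OF assms(1)]
  by (intro Least_equality)

end

(*
Let h x = (x + 1) div 2 be the index of the pair {2m - 1, 2m} containing x. The code consists of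
the preimages under h of the 3-subsets of {1..15} and of {16..30}. One half of [60] contains at
least three elements of S; their h-indices fit into one 3-subset, whose preimage is the required
code word. Conversely {1, 3, 5, 31, 33, 35} meets each half, hence each code word, in at most
three elements.
*)
theory Submission
  imports Defs
begin

definition pair_index :: "nat \<Rightarrow> nat" where
  "pair_index x = (x + 1) div 2"

definition triples :: "nat set \<Rightarrow> nat set set" where
  "triples A = {I. I \<subseteq> A \<and> card I = 3}"

lemma pair_index_double [simp]: "pair_index (2 * m) = m"
  by (simp add: pair_index_def)

lemma surj_pair_index: "surj pair_index"
  by (metis pair_index_double surjI)

lemma P_pair_eq_vimage: "i \<ge> 1 \<Longrightarrow> P_pair i = pair_index -` {i}"
  by (auto simp: P_pair_def pair_index_def)

text \<open>Since 30 + 2i = 2(15 + i), the second family is the first with indices shifted by 15, so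
  one index map serves both.\<close>

lemma Q_pair_eq_vimage: "i \<ge> 1 \<Longrightarrow> Q_pair i = pair_index -` {15 + i}"
  by (auto simp: Q_pair_def pair_index_def)

lemma image_Collect3: "g ` {f i j k | i j k. R i j k} = {g (f i j k) | i j k. R i j k}"
  by blast

text \<open>Sorting a 3-subset gives its strictly increasing enumeration. The offset
  \<open>c\<close> lets one proof cover both index ranges: \<open>c = 0\<close> for the P-words and
  \<open>c = 15\<close> for the Q-words.\<close>

lemma triples_ordered:
  "triples {Suc c..n + c} = {{c + i, c + j, c + k} | i j k. 1 \<le> i \<and> i < j \<and> j < k \<and> k \<le> n}"
  (is "_ = ?R")
proof
  show "triples {Suc c..n + c} \<subseteq> ?R"
  proof
    fix I assume I: "I \<in> triples {Suc c..n + c}"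
    \<comment> \<open>Infinite sets have \<open>card\<close> 0, so cardinality 3 yields the
      finiteness needed to list \<open>I\<close>.\<close>
    then obtain xs where xs: "sorted_wrt (<) xs" "set xs = I" "length xs = 3"
      using sorted_list_of_set.finite_set_strict_sorted[of I]
      by (metis (mono_tags, lifting) card.infinite mem_Collect_eq triples_def zero_neq_numeral)
    from xs(3) obtain x y z where xyz: "xs = [x, y, z]"
      by (auto simp: numeral_3_eq_3 length_Suc_conv)
    have "x < y" "y < z" "I = {x, y, z}" "Suc c \<le> x" "z \<le> n + c"
      using xs xyz I by (auto simp: triples_def)
    \<comment> \<open>The subtractions are exact because every element of \<open>I\<close> exceeds
      \<open>c\<close>.\<close>
    then show "I \<in> ?R"
      by (intro CollectI exI[of _ "x - c"] exI[of _ "y - c"] exI[of _ "z - c"]) auto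
  qed
  show "?R \<subseteq> triples {Suc c..n + c}"
    by (auto simp: triples_def)
qed

lemma pair_code_eq: "pair_code = vimage pair_index ` (triples {1..15} \<union> triples {16..30})"
proof -
  have P: "P_pair i \<union> P_pair j \<union> P_pair k = pair_index -` {i, j, k}"
    and Q: "Q_pair i \<union> Q_pair j \<union> Q_pair k = pair_index -` {15 + i, 15 + j, 15 + k}"
    if "1 \<le> i \<and> i < j \<and> j < k \<and> k \<le> 15" for i j k
    using that by (auto simp: P_pair_eq_vimage Q_pair_eq_vimage)
  have "vimage pair_index ` triples {1..15} =
      {P_pair i \<union> P_pair j \<union> P_pair k | i j k. 1 \<le> i \<and> i < j \<and> j < k \<and> k \<le> 15}"
  proof -
    have "triples {1..15} = {{i, j, k} | i j k. 1 \<le> i \<and> i < j \<and> j < k \<and> k \<le> 15}"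
      using triples_ordered[of 0 15] by simp
    then have "vimage pair_index ` triples {1..15} =
        {pair_index -` {i, j, k} | i j k. 1 \<le> i \<and> i < j \<and> j < k \<and> k \<le> 15}"
      by (simp only: image_Collect3)
    also have "\<dots> = {P_pair i \<union> P_pair j \<union> P_pair k | i j k. 1 \<le> i \<and> i < j \<and> j < k \<and> k \<le> 15}"
      by (intro Collect_cong ex_cong1) (metis P)
    finally show ?thesis .
  qed
  moreover have "vimage pair_index ` triples {16..30} =
      {Q_pair i \<union> Q_pair j \<union> Q_pair k | i j k. 1 \<le> i \<and> i < j \<and> j < k \<and> k \<le> 15}"
  proof -
    have "triples {16..30} = {{15 + i, 15 + j, 15 + k} | i j k. 1 \<le> i \<and> i < j \<and> j < k \<and> k \<le> 15}"
      using triples_ordered[of 15 15] by simp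
    then have "vimage pair_index ` triples {16..30} =
        {pair_index -` {15 + i, 15 + j, 15 + k} | i j k. 1 \<le> i \<and> i < j \<and> j < k \<and> k \<le> 15}"
      by (simp only: image_Collect3)
    also have "\<dots> = {Q_pair i \<union> Q_pair j \<union> Q_pair k | i j k. 1 \<le> i \<and> i < j \<and> j < k \<and> k \<le> 15}"
      by (intro Collect_cong ex_cong1) (metis Q)
    finally show ?thesis .
  qed
  ultimately show ?thesis
    by (simp add: pair_code_def image_Un)
qed

text \<open>Even x is twice its index, odd x is one less. Besides the count of preimages, this
  inclusion gives their finiteness.\<close>

lemma vimage_pair_index_subset:
  "pair_index -` I \<subseteq> (\<lambda>i. 2 * i) ` I \<union> (\<lambda>i. 2 * i - 1) ` I"
proof
  fix x assume x: "x \<in> pair_index -` I"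
  have "x = 2 * pair_index x \<or> x = 2 * pair_index x - 1"
    unfolding pair_index_def by presburger
  with x show "x \<in> (\<lambda>i. 2 * i) ` I \<union> (\<lambda>i. 2 * i - 1) ` I" by blast
qed

text \<open>Each positive index has exactly one even and one odd preimage. Index 0 is excluded
  because its fibre is just {0}.\<close>

lemma card_vimage_pair_index:
  assumes "finite I" "0 \<notin> I"
  shows "card (pair_index -` I) = 2 * card I"
proof -
  have eq: "pair_index -` I = (\<lambda>i. 2 * i) ` I \<union> (\<lambda>i. 2 * i - 1) ` I"
  proof
    show "pair_index -` I \<subseteq> (\<lambda>i. 2 * i) ` I \<union> (\<lambda>i. 2 * i - 1) ` I"
      by (rule vimage_pair_index_subset)
    have "pair_index (2 * i - 1) = i" if "i \<in> I" for i
      using that assms(2) by (cases i) (auto simp: pair_index_def)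
    then show "(\<lambda>i. 2 * i) ` I \<union> (\<lambda>i. 2 * i - 1) ` I \<subseteq> pair_index -` I" by auto
  qed
  \<comment> \<open>Parity separates the two images only for positive j: at j = 0 the truncated
    \<open>2 * j - 1\<close> is the even number 0.\<close>
  have "2 * i \<noteq> 2 * j - 1" if "j \<in> I" for i j :: nat
  proof -
    from that assms(2) have "j \<noteq> 0" by metis
    then show ?thesis by presburger
  qed
  then have disj: "(\<lambda>i. 2 * i) ` I \<inter> (\<lambda>i. 2 * i - 1) ` I = {}" by blast
  have inj: "inj_on (\<lambda>i. 2 * i) I" by (rule inj_onI) simp
  have inj': "inj_on (\<lambda>i. 2 * i - 1) I"
  proof (rule inj_onI)
    fix x y assume "x \<in> I" "y \<in> I" "2 * x - 1 = 2 * y - 1"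
    moreover from this assms(2) have "x \<noteq> 0" "y \<noteq> 0" by metis+
    ultimately show "x = y" by presburger
  qed
  show ?thesis
    using assms(1) disj by (simp add: eq card_Un_disjoint card_image[OF inj] card_image[OF inj', simplified])
qed

text \<open>The halves are the preimages of the two index ranges. This serves both to place code
  words inside [60] and to bound their intersection with the far vertex.\<close>

lemma pair_code_halves:
  assumes "B \<in> pair_code"
  shows "B \<subseteq> {1..30} \<or> B \<subseteq> {31..60}"
proof -
  from assms consider I where "B = pair_index -` I" "I \<subseteq> {1..15}"
    | I where "B = pair_index -` I" "I \<subseteq> {16..30}"
    by (auto simp: pair_code_eq triples_def)
  then show ?thesis
  proof cases
    case 1
    have "x \<in> {1..30}" if "pair_index x \<in> {1..15}" for x
      using that by (auto simp: pair_index_def)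
    with 1 show ?thesis by blast
  next
    case 2
    have "x \<in> {31..60}" if "pair_index x \<in> {16..30}" for x
      using that by (auto simp: pair_index_def)
    with 2 show ?thesis by blast
  qed
qed

lemma pair_code_johnson_vertices: "pair_code \<subseteq> johnson_vertices 60 6"
proof
  fix B assume B: "B \<in> pair_code"
  then obtain I where I: "B = pair_index -` I" "I \<subseteq> {1..15} \<or> I \<subseteq> {16..30}" "card I = 3"
    by (auto simp: pair_code_eq triples_def)
  have "finite I" using I(3) card.infinite by fastforce
  moreover have "0 \<notin> I" using I(2) by auto
  ultimately have "card B = 6"
    using I by (simp add: card_vimage_pair_index)
  moreover have "{1..30} \<subseteq> {1..60::nat}" "{31..60} \<subseteq> {1..60::nat}" by auto
  then have "B \<subseteq> {1..60}" using pair_code_halves[OF B] by blast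
  ultimately show "B \<in> johnson_vertices 60 6"
    by (simp add: johnson_vertices_def)
qed

text \<open>The two index ranges are disjoint, so there are 455 + 455 triples, and no two share a
  preimage because taking preimages under a surjection is injective.\<close>

lemma card_pair_code: "card pair_code = 910"
proof -
  have c: "card (triples A) = card A choose 3" "finite (triples A)" if "finite A" for A
    using that by (simp_all add: triples_def n_subsets)
  \<comment> \<open>Evaluated from 3! * 12! * (15 choose 3) = 15!.\<close>
  have "(15::nat) choose 3 = 455"
    using binomial_fact_lemma[of 3 15] by (simp add: fact_numeral)
  moreover have "triples {1..15} \<inter> triples {16..30} = {}"
  proof -
    have False if "I \<subseteq> {1..15}" "I \<subseteq> {16..30}" "card I = 3" for I :: "nat set"
    proof -
      have "I \<subseteq> {1..15} \<inter> {16..30}" using that by blast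
      also have "\<dots> = {}" by auto
      finally show False using that(3) by simp
    qed
    then show ?thesis unfolding triples_def by blast
  qed
  ultimately have "card (triples {1..15} \<union> triples {16..30}) = 910"
    using c[of "{1..15}"] c[of "{16..30}"] by (simp add: card_Un_disjoint)
  moreover have "inj (vimage pair_index)"
    by (metis injI surj_image_vimage_eq surj_pair_index)
  ultimately show ?thesis
    unfolding pair_code_eq by (metis card_image inj_on_subset subset_UNIV)
qed

lemma triple_vimage_meets:
  assumes S: "card (S \<inter> pair_index -` A) \<ge> 3" and A: "finite A" "card A \<ge> 3"
  shows "\<exists>I\<in>triples A. card (S \<inter> pair_index -` I) \<ge> 3"
proof -
  obtain T where T: "T \<subseteq> S \<inter> pair_index -` A" "card T = 3" "finite T"
    using obtain_subset_with_card_n[OF S] by blast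
  then have "card (pair_index ` T) \<le> 3" using card_image_le by metis
  moreover have "pair_index ` T \<subseteq> A" using T by blast
  \<comment> \<open>Two points of \<open>T\<close> may share an index, so the image can have fewer
    than three elements; \<open>card A \<ge> 3\<close> leaves room to enlarge it to exactly
    three.\<close>
  ultimately obtain I where I: "pair_index ` T \<subseteq> I" "I \<subseteq> A" "card I = 3"
    using exists_subset_between[of "pair_index ` T" 3 A] A by blast
  have "finite I" using I A finite_subset by blast
  \<comment> \<open>\<open>S\<close> is not assumed finite, so the finiteness for
    \<open>card_mono\<close> comes from the preimage of \<open>I\<close>.\<close>
  then have "finite (S \<inter> pair_index -` I)"
    using finite_subset[OF vimage_pair_index_subset] by simp
  then have "card T \<le> card (S \<inter> pair_index -` I)"
    using T I by (intro card_mono) auto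
  with T I show ?thesis unfolding triples_def by auto
qed

lemma pair_code_covers:
  assumes "S \<subseteq> {1..60}" "card S = 6"
  shows "\<exists>B\<in>pair_code. card (S \<inter> B) \<ge> 3"
proof -
  have "x \<in> pair_index -` {1..15} \<union> pair_index -` {16..30}" if "x \<in> {1..60}" for x
    using that by (auto simp: pair_index_def)
  then have "S = (S \<inter> pair_index -` {1..15}) \<union> (S \<inter> pair_index -` {16..30})"
    using assms(1) by blast
  then have "6 \<le> card (S \<inter> pair_index -` {1..15}) + card (S \<inter> pair_index -` {16..30})"
    using assms(2) card_Un_le by metis
  then consider "card (S \<inter> pair_index -` {1..15}) \<ge> 3" | "card (S \<inter> pair_index -` {16..30}) \<ge> 3"
    by linarith
  then show ?thesis
    unfolding pair_code_eq
    by cases (use triple_vimage_meets[of S "{1..15}"] triple_vimage_meets[of S "{16..30}"] in auto)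
qed

lemma pair_code_far_vertex:
  "\<exists>S\<in>johnson_vertices 60 6. \<forall>B\<in>pair_code. 3 \<le> johnson_dist 6 S B"
proof
  \<comment> \<open>Only the 3 + 3 split between the halves matters for the bound.\<close>
  let ?S = "{1, 3, 5, 31, 33, 35} :: nat set"
  show "?S \<in> johnson_vertices 60 6" by (simp add: johnson_vertices_def)
  show "\<forall>B\<in>pair_code. 3 \<le> johnson_dist 6 ?S B"
  proof
    fix B assume "B \<in> pair_code"
    then have "?S \<inter> B \<subseteq> ?S \<inter> {1..30} \<or> ?S \<inter> B \<subseteq> ?S \<inter> {31..60}"
      using pair_code_halves by blast
    moreover have "?S \<inter> {1..30} = {1, 3, 5}" "?S \<inter> {31..60} = {31, 33, 35}" by auto
    ultimately have "?S \<inter> B \<subseteq> {1, 3, 5} \<or> ?S \<inter> B \<subseteq> {31, 33, 35}" by metis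
    then have "card (?S \<inter> B) \<le> card {1, 3, 5 :: nat} \<or> card (?S \<inter> B) \<le> card {31, 33, 35 :: nat}"
      by (meson card_mono finite.emptyI finite.insertI)
    then show "3 \<le> johnson_dist 6 ?S B" by (simp add: johnson_dist_def)
  qed
qed

lemma finite_johnson_vertices: "finite (johnson_vertices n k)"
  by (rule finite_subset[of _ "Pow {1..n}"]) (auto simp: johnson_vertices_def)

text \<open>Trades the max-min for two quantified bounds: \<open>le\<close> bounds every inner
  minimum by \<open>r\<close>, and the vertex from \<open>ge\<close> attains it.\<close>

lemma johnson_covering_radius_eqI:
  assumes C: "C \<subseteq> johnson_vertices n k" "C \<noteq> {}"
    and le: "\<forall>S\<in>johnson_vertices n k. \<exists>B\<in>C. johnson_dist k S B \<le> r"
    and ge: "\<exists>S\<in>johnson_vertices n k. \<forall>B\<in>C. r \<le> johnson_dist k S B"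
  shows "johnson_covering_radius n k C = r"
proof -
  have fin: "finite C" using C(1) finite_johnson_vertices finite_subset by blast
  let ?d = "\<lambda>S. Min (johnson_dist k S ` C)"
  have upper: "?d S \<le> r" if "S \<in> johnson_vertices n k" for S
    using le that fin C(2) by (simp add: Min_le_iff)
  obtain S where S: "S \<in> johnson_vertices n k" "r \<le> ?d S"
    using ge fin C(2) by auto
  \<comment> \<open>\<open>Max_eqI\<close> requires \<open>r\<close> to be a value of the inner
    minimum, not merely an upper bound.\<close>
  then have "?d S = r" using upper by (simp add: order_antisym)
  with S have "r \<in> ?d ` johnson_vertices n k" by blast
  then show ?thesis
    unfolding johnson_covering_radius_def
    using upper finite_johnson_vertices by (intro Max_eqI) auto
qed

theorem theorem1:
  shows "pair_code \<subseteq> johnson_vertices 60 6 \<and> card pair_code = 910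
    \<and> (\<forall>S. S \<subseteq> {1..60} \<and> card S = 6 \<longrightarrow> (\<exists>B\<in>pair_code. card (S \<inter> B) \<ge> 3))
    \<and> (\<forall>S\<in>johnson_vertices 60 6. \<exists>B\<in>pair_code. johnson_dist 6 S B \<le> 3)
    \<and> johnson_covering_radius 60 6 pair_code = 3"
proof -
  have dist: "\<forall>S\<in>johnson_vertices 60 6. \<exists>B\<in>pair_code. johnson_dist 6 S B \<le> 3"
  proof
    fix S assume "S \<in> johnson_vertices 60 6"
    then obtain B where "B \<in> pair_code" "card (S \<inter> B) \<ge> 3"
      using pair_code_covers by (auto simp: johnson_vertices_def)
    then show "\<exists>B\<in>pair_code. johnson_dist 6 S B \<le> 3"
      by (intro bexI[of _ B]) (auto simp: johnson_dist_def)
  qed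
  have "pair_code \<noteq> {}" using card_pair_code by auto
  then have "johnson_covering_radius 60 6 pair_code = 3"
    by (rule johnson_covering_radius_eqI[OF pair_code_johnson_vertices _ dist pair_code_far_vertex])
  then show ?thesis
    using pair_code_johnson_vertices card_pair_code pair_code_covers dist by blast
qed

end
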